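(* Assume that $g \in L^{\left(\frac{p^{*}}{\beta+1}\right)'}(\Omega)$. Assume that one of the following two alternatives holds. (F1) $f$ is not identically zero, and one of the following conditions is satisfied: - $\alpha<1$ and $f\in L^{\left(\frac{p^{*}}{1-\alpha}\right)'}(\Omega)$; - $\alpha=1$ and $f\in L^{r}(\Omega)$ for some $r>1$; - $\alpha>1$ and $f\in L^{1}(\Omega)$. (F2) There are $\delta\in[0,p)$ and constants $C_1,C_2>0$ such that $C_1 d(x)^{-\delta}\le f(x)\le C_2 d(x)^{-\delta}$ for any $x\in\Omega$, and moreover $\delta<1+\frac1{p'}$. Let $u$ be the unique weak solution (in the sense defined in the context), if it exists, of the problem $$-\Delta_p u+(-\Delta)^s_q u=f(x)u^{-\alpha}+g(x)u^{\beta},\quad u>0\ \text{in }\Omega;\qquad u=0\ \text{in }\mathbb R^N\setminus\Omega .$$ Suppose that $\Omega$ is symmetric with respect to the hyperplane $\mathcal H^{\upsilon}_{\lambda}:=\{x\cdot\upsilon=\lambda\}$, where $\lambda\in\mathbb R$ and $\upsilon\in S^{N-1}$ (the unit sphere of $\mathbb R^N$). If, in addition, both $f$ and $g$ are symmetric with respect to $\mathcal H^{\upsilon}_{\lambda}$, then $u$ is symmetric with respect to $\mathcal H^{\upsilon}_{\lambda}$. In particular, when $\Omega$ is a ball or an annulus centered at the origin and $f$ and $g$ are radially symmetric, the solution $u$ is also radially symmetric.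
   Context: Standing assumptions: $\Omega\subset\mathbb R^N$ is a bounded open domain with $C^2$ boundary, $0<s<1$, $1<q\le p<\infty$, $N>p$, $0<\beta<q-1$, $\alpha>0$; $f:\Omega\to[0,\infty)$ and $g:\Omega\to[0,\infty)$ are measurable. Notation: $[\xi]^{r-1}:=|\xi|^{r-2}\xi$ for $r>1$ and $\xi$ a real number or a vector; $r'$ is the conjugate exponent of $r$; $p^*=\frac{Np}{N-p}$; $d(x)=\mathrm{dist}(x,\partial\Omega)$. $\Delta_p u=\mathrm{div}(|\nabla u|^{p-2}\nabla u)$ and $(-\Delta)^s_q u(x)=2\,\mathrm{P.V.}\int_{\mathbb R^N}\frac{[u(x)-u(y)]^{q-1}}{|x-y|^{N+sq}}dy$. $W^{1,p}_0(\Omega)$ is the set of $u\in W^{1,p}(\mathbb R^N)$ with $u=0$ a.e. in $\mathbb R^N\setminus\Omega$, normed by $\|\nabla u\|_{L^p(\Omega)}$; $L^\infty_c(\Omega)$ is the set of $L^\infty$ functions with compact support in $\Omega$. Functions are extended by $0$ outside $\Omega$. A set or function is symmetric with respect to a hyperplane if it is invariant under the orthogonal reflection across it (a.e. for functions defined a.e.). Definition. A function $u\in W^{1,p}_{\mathrm{loc}}(\Omega)$ is a weak super-solution of the problem if: (i) there is a constant $\theta\ge1$ such that $u^\theta\in W^{1,p}_0(\Omega)$; (ii) for any $K\Subset\Omega$ there is a constant $C(K)>0$ such that $u\ge C(K)$ in $K$; (iii) for all $\varphi\in W^{1,p}_0(\Omega)\cap L^\infty_c(\Omega)$ with $\varphi\ge0$,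 $$\int_\Omega[\nabla u]^{p-1}\nabla\varphi\,dx+\iint_{\mathbb R^{2N}}\frac{[u(x)-u(y)]^{q-1}(\varphi(x)-\varphi(y))}{|x-y|^{N+sq}}dx\,dy\ \ge\ \int_\Omega\left(f(x)u^{-\alpha}+g(x)u^{\beta}\right)\varphi\,dx .$$ It is a weak sub-solution if (i), (ii) hold together with the reversed inequality in (iii). A weak solution is a function that is both a weak sub-solution and a weak super-solution. *)

theory Defs
  imports "HOL-Analysis.Analysis"
begin

text \<open>
  The space \<open>\<real>\<^sup>N\<close> is an arbitrary Euclidean space of type \<open>'a\<close> with \<open>N = DIM('a)\<close>.  ``Measurable''
  and ``almost everywhere'' refer to Lebesgue measure.  Integrals are Bochner integrals, which are
  \<open>0\<close> for non-integrable functions; integrability is therefore required explicitly unless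
  it is evident, as for locally integrable functions tested against smooth functions of compact
  support.
\<close>

subsection \<open>Smooth functions and regular domains\<close>

primrec Ck :: "nat \<Rightarrow> ('a::euclidean_space \<Rightarrow> real) \<Rightarrow> bool" where
  "Ck 0 \<phi> \<longleftrightarrow> continuous_on UNIV \<phi>"
| "Ck (Suc k) \<phi> \<longleftrightarrow>
     (\<exists>D. (\<forall>x. GDERIV \<phi> x :> D x) \<and> (\<forall>b\<in>Basis. Ck k (\<lambda>x. D x \<bullet> b)))"

text \<open>
  Near each boundary point the open set lies strictly above the graph of a \<open>C\<^sup>2\<close> function over
  the hyperplane orthogonal to some unit vector \<open>e\<close>.  The function of \<open>N - 1\<close> variables is
  represented by a function \<open>\<gamma>\<close> on the whole space which is evaluated only at orthogonal
  projections onto that hyperplane.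
\<close>
definition C2_boundary :: "'a::euclidean_space set \<Rightarrow> bool" where
  "C2_boundary \<Omega> \<longleftrightarrow>
     (\<forall>x0\<in>frontier \<Omega>. \<exists>r>0. \<exists>e \<gamma>. norm e = 1 \<and> Ck 2 \<gamma> \<and>
        \<Omega> \<inter> ball x0 r = {x \<in> ball x0 r. x \<bullet> e > \<gamma> (x - (x \<bullet> e) *\<^sub>R e)})"

definition bounded_C2_domain :: "'a::euclidean_space set \<Rightarrow> bool" where
  "bounded_C2_domain \<Omega> \<longleftrightarrow>
     open \<Omega> \<and> connected \<Omega> \<and> \<Omega> \<noteq> {} \<and> bounded \<Omega> \<and> C2_boundary \<Omega>"


subsection \<open>Lebesgue and Sobolev spaces\<close>

definition Lp :: "'a::euclidean_space set \<Rightarrow> real \<Rightarrow> ('a \<Rightarrow> 'b::euclidean_space) \<Rightarrow> bool" where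
  "Lp \<Omega> r h \<longleftrightarrow> h \<in> borel_measurable (lebesgue_on \<Omega>) \<and>
     integrable (lebesgue_on \<Omega>) (\<lambda>x. norm (h x) powr r)"

definition Lp_loc :: "'a::euclidean_space set \<Rightarrow> real \<Rightarrow> ('a \<Rightarrow> 'b::euclidean_space) \<Rightarrow> bool" where
  "Lp_loc \<Omega> r h \<longleftrightarrow> (\<forall>K. compact K \<and> K \<subseteq> \<Omega> \<longrightarrow> Lp K r h)"

text \<open>\<open>G\<close> is the distributional gradient of \<open>u\<close> in the open set \<open>\<Omega>\<close>; it is unique up to null sets.\<close>
definition weak_gradient ::
    "'a::euclidean_space set \<Rightarrow> ('a \<Rightarrow> real) \<Rightarrow> ('a \<Rightarrow> 'a) \<Rightarrow> bool" where
  "weak_gradient \<Omega> u G \<longleftrightarrow> Lp_loc \<Omega> 1 u \<and> Lp_loc \<Omega> 1 G \<and>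
     (\<forall>\<phi> D. (\<forall>k. Ck k \<phi>) \<and> (\<forall>x. GDERIV \<phi> x :> D x) \<and>
        compact (closure {x. \<phi> x \<noteq> 0}) \<and> closure {x. \<phi> x \<noteq> 0} \<subseteq> \<Omega> \<longrightarrow>
        (LINT x|lebesgue_on \<Omega>. u x *\<^sub>R D x) = - (LINT x|lebesgue_on \<Omega>. \<phi> x *\<^sub>R G x))"

definition W1p :: "'a::euclidean_space set \<Rightarrow> real \<Rightarrow> ('a \<Rightarrow> real) \<Rightarrow> bool" where
  "W1p \<Omega> p u \<longleftrightarrow> Lp \<Omega> p u \<and> (\<exists>G. weak_gradient \<Omega> u G \<and> Lp \<Omega> p G)"

definition W1p_loc :: "'a::euclidean_space set \<Rightarrow> real \<Rightarrow> ('a \<Rightarrow> real) \<Rightarrow> bool" where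
  "W1p_loc \<Omega> p u \<longleftrightarrow> Lp_loc \<Omega> p u \<and> (\<exists>G. weak_gradient \<Omega> u G \<and> Lp_loc \<Omega> p G)"

definition W1p0 :: "'a::euclidean_space set \<Rightarrow> real \<Rightarrow> ('a \<Rightarrow> real) \<Rightarrow> bool" where
  "W1p0 \<Omega> p u \<longleftrightarrow> W1p UNIV p u \<and> (AE x in lebesgue. x \<notin> \<Omega> \<longrightarrow> u x = 0)"

definition Linf_c :: "'a::euclidean_space set \<Rightarrow> ('a \<Rightarrow> real) \<Rightarrow> bool" where
  "Linf_c \<Omega> \<phi> \<longleftrightarrow> \<phi> \<in> borel_measurable lebesgue \<and>
     (\<exists>M. AE x in lebesgue. \<bar>\<phi> x\<bar> \<le> M) \<and>
     (\<exists>K. compact K \<and> K \<subseteq> \<Omega> \<and> (AE x in lebesgue. x \<notin> K \<longrightarrow> \<phi> x = 0))"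

definition conj_exp :: "real \<Rightarrow> real" where
  "conj_exp r = r / (r - 1)"

definition sobolev_exp :: "'a::euclidean_space itself \<Rightarrow> real \<Rightarrow> real" where
  "sobolev_exp _ p = real DIM('a) * p / (real DIM('a) - p)"


subsection \<open>The problem\<close>

text \<open>\<open>spow t \<xi>\<close> is \<open>[\<xi>]\<^sup>t\<close>, that is, \<open>|\<xi>|\<^bsup>t-1\<^esup> \<xi>\<close>.\<close>
definition spow :: "real \<Rightarrow> 'b::real_normed_vector \<Rightarrow> 'b" where
  "spow t \<xi> = norm \<xi> powr (t - 1) *\<^sub>R \<xi>"

definition local_integrand ::
    "real \<Rightarrow> ('a::euclidean_space \<Rightarrow> 'a) \<Rightarrow> ('a \<Rightarrow> 'a) \<Rightarrow> 'a \<Rightarrow> real" where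
  "local_integrand p G H x = spow (p - 1) (G x) \<bullet> H x"

definition nonlocal_integrand ::
    "real \<Rightarrow> real \<Rightarrow> ('a::euclidean_space \<Rightarrow> real) \<Rightarrow> ('a \<Rightarrow> real) \<Rightarrow> 'a \<times> 'a \<Rightarrow> real" where
  "nonlocal_integrand s q u \<phi> = (\<lambda>(x, y).
     spow (q - 1) (u x - u y) * (\<phi> x - \<phi> y) / norm (x - y) powr (real DIM('a) + s * q))"

definition source_integrand ::
    "real \<Rightarrow> real \<Rightarrow> ('a \<Rightarrow> real) \<Rightarrow> ('a \<Rightarrow> real) \<Rightarrow> ('a \<Rightarrow> real) \<Rightarrow> ('a \<Rightarrow> real) \<Rightarrow> 'a \<Rightarrow> real" where
  "source_integrand \<alpha> \<beta> f g u \<phi> x = (f x * u x powr (- \<alpha>) + g x * u x powr \<beta>) * \<phi> x"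

text \<open>
  Conditions (i) and (ii) of the notion of weak sub- and super-solution.  The second conjunct
  is the convention that functions are extended by \<open>0\<close> outside \<open>\<Omega>\<close>.
\<close>
definition admissible :: "'a::euclidean_space set \<Rightarrow> real \<Rightarrow> ('a \<Rightarrow> real) \<Rightarrow> bool" where
  "admissible \<Omega> p u \<longleftrightarrow>
     W1p_loc \<Omega> p u \<and>
     (AE x in lebesgue. x \<notin> \<Omega> \<longrightarrow> u x = 0) \<and>
     (\<exists>\<theta>\<ge>1. W1p0 \<Omega> p (\<lambda>x. u x powr \<theta>)) \<and>
     (\<forall>K. compact (closure K) \<and> closure K \<subseteq> \<Omega> \<longrightarrow>
        (\<exists>C>0. AE x in lebesgue. x \<in> K \<longrightarrow> C \<le> u x))"

text \<open>
  The weak inequality (iii), with \<open>R\<close> being \<open>(\<ge>)\<close> for super- and \<open>(\<le>)\<close> for sub-solutions.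
  The functions \<open>G\<close> and \<open>H\<close> are the weak gradients of \<open>u\<close> and of the test function \<open>\<phi>\<close>; since
  these are unique up to null sets, the quantifiers binding them are immaterial.
\<close>
definition weak_ineq ::
    "(real \<Rightarrow> real \<Rightarrow> bool) \<Rightarrow> 'a::euclidean_space set \<Rightarrow> real \<Rightarrow> real \<Rightarrow> real \<Rightarrow> real \<Rightarrow> real \<Rightarrow>
     ('a \<Rightarrow> real) \<Rightarrow> ('a \<Rightarrow> real) \<Rightarrow> ('a \<Rightarrow> real) \<Rightarrow> bool" where
  "weak_ineq R \<Omega> s p q \<alpha> \<beta> f g u \<longleftrightarrow>
     (\<exists>G. weak_gradient \<Omega> u G \<and> Lp_loc \<Omega> p G \<and>
       (\<forall>\<phi> H. W1p0 \<Omega> p \<phi> \<and> Linf_c \<Omega> \<phi> \<and> (AE x in lebesgue. 0 \<le> \<phi> x) \<and>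
          weak_gradient UNIV \<phi> H \<longrightarrow>
          integrable (lebesgue_on \<Omega>) (local_integrand p G H) \<and>
          integrable lebesgue (nonlocal_integrand s q u \<phi>) \<and>
          integrable (lebesgue_on \<Omega>) (source_integrand \<alpha> \<beta> f g u \<phi>) \<and>
          R ((LINT x|lebesgue_on \<Omega>. local_integrand p G H x) +
             (LINT z|lebesgue. nonlocal_integrand s q u \<phi> z))
            (LINT x|lebesgue_on \<Omega>. source_integrand \<alpha> \<beta> f g u \<phi> x)))"

definition weak_supersolution ::
    "'a::euclidean_space set \<Rightarrow> real \<Rightarrow> real \<Rightarrow> real \<Rightarrow> real \<Rightarrow> real \<Rightarrow>
     ('a \<Rightarrow> real) \<Rightarrow> ('a \<Rightarrow> real) \<Rightarrow> ('a \<Rightarrow> real) \<Rightarrow> bool" where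
  "weak_supersolution \<Omega> s p q \<alpha> \<beta> f g u \<longleftrightarrow>
     admissible \<Omega> p u \<and> weak_ineq (\<ge>) \<Omega> s p q \<alpha> \<beta> f g u"

definition weak_subsolution ::
    "'a::euclidean_space set \<Rightarrow> real \<Rightarrow> real \<Rightarrow> real \<Rightarrow> real \<Rightarrow> real \<Rightarrow>
     ('a \<Rightarrow> real) \<Rightarrow> ('a \<Rightarrow> real) \<Rightarrow> ('a \<Rightarrow> real) \<Rightarrow> bool" where
  "weak_subsolution \<Omega> s p q \<alpha> \<beta> f g u \<longleftrightarrow>
     admissible \<Omega> p u \<and> weak_ineq (\<le>) \<Omega> s p q \<alpha> \<beta> f g u"

definition weak_solution ::
    "'a::euclidean_space set \<Rightarrow> real \<Rightarrow> real \<Rightarrow> real \<Rightarrow> real \<Rightarrow> real \<Rightarrow>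
     ('a \<Rightarrow> real) \<Rightarrow> ('a \<Rightarrow> real) \<Rightarrow> ('a \<Rightarrow> real) \<Rightarrow> bool" where
  "weak_solution \<Omega> s p q \<alpha> \<beta> f g u \<longleftrightarrow>
     weak_subsolution \<Omega> s p q \<alpha> \<beta> f g u \<and> weak_supersolution \<Omega> s p q \<alpha> \<beta> f g u"

definition unique_weak_solution ::
    "'a::euclidean_space set \<Rightarrow> real \<Rightarrow> real \<Rightarrow> real \<Rightarrow> real \<Rightarrow> real \<Rightarrow>
     ('a \<Rightarrow> real) \<Rightarrow> ('a \<Rightarrow> real) \<Rightarrow> ('a \<Rightarrow> real) \<Rightarrow> bool" where
  "unique_weak_solution \<Omega> s p q \<alpha> \<beta> f g u \<longleftrightarrow>
     weak_solution \<Omega> s p q \<alpha> \<beta> f g u \<and>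
     (\<forall>v. weak_solution \<Omega> s p q \<alpha> \<beta> f g v \<longrightarrow> (AE x in lebesgue. v x = u x))"


subsection \<open>Assumptions on the singular coefficient\<close>

definition cond_F1 :: "'a::euclidean_space set \<Rightarrow> real \<Rightarrow> real \<Rightarrow> ('a \<Rightarrow> real) \<Rightarrow> bool" where
  "cond_F1 \<Omega> p \<alpha> f \<longleftrightarrow>
     \<not> (AE x in lebesgue. x \<in> \<Omega> \<longrightarrow> f x = 0) \<and>
     (\<alpha> < 1 \<and> Lp \<Omega> (conj_exp (sobolev_exp TYPE('a) p / (1 - \<alpha>))) f \<or>
      \<alpha> = 1 \<and> (\<exists>r>1. Lp \<Omega> r f) \<or>
      \<alpha> > 1 \<and> Lp \<Omega> 1 f)"

definition cond_F2 :: "'a::euclidean_space set \<Rightarrow> real \<Rightarrow> ('a \<Rightarrow> real) \<Rightarrow> bool" where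
  "cond_F2 \<Omega> p f \<longleftrightarrow>
     (\<exists>\<delta> C1 C2. 0 \<le> \<delta> \<and> \<delta> < p \<and> \<delta> < 1 + 1 / conj_exp p \<and> C1 > 0 \<and> C2 > 0 \<and>
        (\<forall>x\<in>\<Omega>. C1 * infdist x (frontier \<Omega>) powr (- \<delta>) \<le> f x \<and>
                f x \<le> C2 * infdist x (frontier \<Omega>) powr (- \<delta>)))"


subsection \<open>Symmetry\<close>

definition hyperplane_reflection :: "'a::euclidean_space \<Rightarrow> real \<Rightarrow> 'a \<Rightarrow> 'a" where
  "hyperplane_reflection \<upsilon> c x = x - (2 * (x \<bullet> \<upsilon> - c)) *\<^sub>R \<upsilon>"

definition symmetric_set :: "'a::euclidean_space \<Rightarrow> real \<Rightarrow> 'a set \<Rightarrow> bool" where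
  "symmetric_set \<upsilon> c \<Omega> \<longleftrightarrow> hyperplane_reflection \<upsilon> c ` \<Omega> = \<Omega>"

definition symmetric_on ::
    "'a::euclidean_space set \<Rightarrow> 'a \<Rightarrow> real \<Rightarrow> ('a \<Rightarrow> real) \<Rightarrow> bool" where
  "symmetric_on \<Omega> \<upsilon> c h \<longleftrightarrow>
     (AE x in lebesgue. x \<in> \<Omega> \<longrightarrow> h (hyperplane_reflection \<upsilon> c x) = h x)"

definition radial_on :: "'a::euclidean_space set \<Rightarrow> ('a \<Rightarrow> real) \<Rightarrow> bool" where
  "radial_on \<Omega> h \<longleftrightarrow> (\<exists>\<rho>::real \<Rightarrow> real. AE x in lebesgue. x \<in> \<Omega> \<longrightarrow> h x = \<rho> (norm x))"

end

theory Submission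
  imports Defs
begin

text \<open>
  The problem is invariant under isometries of \<open>\<real>\<^sup>N\<close>.  If \<open>R\<close> is the reflection across a hyperplane with
  respect to which \<open>\<Omega>\<close>, \<open>f\<close> and \<open>g\<close> are symmetric, then \<open>u \<circ> R\<close> is again a weak solution
  (\<open>weak_solution_reflect\<close>), and uniqueness forces \<open>u \<circ> R = u\<close> almost everywhere
  (\<open>unique_weak_solution_symmetric\<close>).  The work consists in transporting every ingredient of the
  notion of solution along \<open>R\<close>: Lebesgue measure (\<open>distr_lebesgue\<close>), smooth functions, weak gradients, Sobolev
  spaces, and the three integrals.  Under \<open>R\<close> a gradient is rotated by the linear part \<open>L\<close> of
  \<open>R\<close>, and since \<open>L\<close> is a symmetric orthogonal map it moves from one factor of an inner product
  to the other.

  In the radial case the argument applies to all reflections through the origin and yields a function invariant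
  under each of them, but with an exceptional null set depending on the reflection.  To
  conclude that \<open>u\<close> is radial almost everywhere (\<open>radial_if_symmetric\<close>), Fubini's theorem exchanges ``for every
  reflection, for almost every point'' for ``for almost every point, for almost every reflection'', and the
  reflections are then parametrised by the direction into which they move a given point.
\<close>


section \<open>Isometric involutions and Lebesgue measure\<close>

text \<open>
  The linear part \<open>L\<close> of the affine map \<open>R\<close> is carried along because it acts on gradients.
  Hyperplane reflections are the motivating case, but the nonlocal term lives on
  \<open>\<real>\<^sup>N \<times> \<real>\<^sup>N\<close>, where the diagonal map \<open>(x, y) \<mapsto> (R x, R y)\<close> is not a hyperplane reflection
  and still an isometric involution.
\<close>
locale isometric_involution =
  fixes R L :: "'a::euclidean_space \<Rightarrow> 'a"
  assumes linear_part: "linear L"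
    and norm_part: "norm (L x) = norm x"
    and diff_eq: "R x - R y = L (x - y)"
    and involution: "R (R x) = x"
begin

lemma part_involution: "L (L x) = x"
proof -
  have "L x = R x - R 0" by (simp add: diff_eq)
  then have "L (L x) = R (R x) - R (R 0)" by (simp add: diff_eq)
  then show ?thesis by (simp add: involution)
qed

lemma inner_part: "L x \<bullet> L y = x \<bullet> y"
  using linear_part norm_part orthogonal_transformation[of L] by (simp add: orthogonal_transformation_def)

lemma part_selfadjoint: "L x \<bullet> y = x \<bullet> L y"
  by (metis inner_part part_involution)

lemma bounded_linear_part: "bounded_linear L"
  using linear_part linear_conv_bounded_linear by blast

lemma add_eq: "R (x + y) = R x + L y"
  using diff_eq[of "x + y" x] by (simp add: algebra_simps)

lemma dist_eq: "dist (R x) (R y) = dist x y"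
  by (simp add: dist_norm diff_eq norm_part)

lemma continuous: "continuous_on S R"
  by (auto simp: continuous_on_iff dist_eq)

lemma image_eq_vimage: "R ` S = R -` S"
proof
  show "R ` S \<subseteq> R -` S" by (auto simp: involution)
  show "R -` S \<subseteq> R ` S"
  proof
    fix x assume "x \<in> R -` S"
    then show "x \<in> R ` S" by (intro image_eqI[of _ R "R x"]) (simp_all add: involution)
  qed
qed

lemma image_twice: "R ` R ` S = S"
  by (simp add: image_comp o_def involution)

lemma mem_image: "R x \<in> R ` S \<longleftrightarrow> x \<in> S"
  by (simp add: image_eq_vimage involution)

lemma has_derivative: "(R has_derivative L) (at x)"
proof -
  have "R = (\<lambda>x. R 0 + L x)" by (rule ext) (metis add_0 add_eq)
  moreover have "((\<lambda>x. R 0 + L x) has_derivative L) (at x)"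
    using bounded_linear_part by (auto intro!: derivative_eq_intros bounded_linear_imp_has_derivative)
  ultimately show ?thesis by simp
qed

lemma closure_image: "closure (R ` S) = R ` closure S"
proof
  show "R ` closure S \<subseteq> closure (R ` S)"
    by (rule image_closure_subset[OF continuous]) (auto simp: closure_subset)
  have "closed (R -` closure S)"
    using continuous_closed_vimage[of "closure S" R] continuous[of UNIV]
    by (auto simp: continuous_on_eq_continuous_at)
  then show "closure (R ` S) \<subseteq> R ` closure S"
    by (simp add: closure_minimal image_mono closure_subset flip: image_eq_vimage)
qed

lemma borel_measurable_R: "R \<in> borel_measurable borel"
  by (intro borel_measurable_continuous_onI continuous)

text \<open>
  With \<open>\<lambda>\<close> Lebesgue measure and \<open>B\<close> the unit ball, the double integral of \<open>1\<^sub>A(R x) 1\<^sub>B(y)\<close> is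
  \<open>\<lambda>(R\<^sup>-\<^sup>1 A) \<lambda>(B)\<close>.  Translating first \<open>x\<close> by \<open>L y\<close> and then \<open>y\<close> by \<open>- R x\<close> turns the integrand into
  \<open>1\<^sub>A(y) 1\<^sub>B(y - R x)\<close>.  Since \<open>R\<close> is an isometric involution, \<open>|y - R x| = |x - R y|\<close>, so the integral
  over \<open>x\<close> is the measure of a unit ball and the total is \<open>\<lambda>(A) \<lambda>(B)\<close>.  Only translation
  invariance and Fubini's theorem enter.
\<close>
lemma emeasure_lborel_vimage:
  assumes A[measurable]: "A \<in> sets borel"
  shows "emeasure lborel (R -` A) = emeasure lborel A"
proof -
  note [measurable] = borel_measurable_R
  define B :: "'a set" where "B = ball 0 1"
  have B[measurable]: "B \<in> sets borel" by (simp add: B_def)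
  have "emeasure lborel (R -` A) * emeasure lborel B
      = (\<integral>\<^sup>+y. (\<integral>\<^sup>+x. indicator A (R x) * indicator B y \<partial>lborel) \<partial>lborel)"
  proof -
    have "(\<integral>\<^sup>+x. indicator A (R x) \<partial>lborel) = (\<integral>\<^sup>+x. indicator (R -` A) x \<partial>lborel)"
      by (simp add: indicator_vimage o_def)
    also have "\<dots> = emeasure lborel (R -` A)"
      using measurable_sets[OF borel_measurable_R A] by (simp add: nn_integral_indicator)
    finally show ?thesis
      by (simp add: nn_integral_multc nn_integral_cmult)
  qed
  also have "\<dots> = (\<integral>\<^sup>+y. (\<integral>\<^sup>+x. indicator A (R x + y) * indicator B y \<partial>lborel) \<partial>lborel)"
  proof (rule nn_integral_cong)
    fix y
    have "(\<integral>\<^sup>+x. indicator A (R x) * indicator B y \<partial>lborel)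
        = (\<integral>\<^sup>+x. indicator A (R (L y + x)) * indicator B y \<partial>lborel)"
      by (subst lborel_distr_plus[of "L y", symmetric]) (simp add: nn_integral_distr)
    also have "\<dots> = (\<integral>\<^sup>+x. indicator A (R x + y) * indicator B y \<partial>lborel)"
      by (subst add.commute) (simp add: add_eq part_involution)
    finally show "(\<integral>\<^sup>+x. indicator A (R x) * indicator B y \<partial>lborel)
        = (\<integral>\<^sup>+x. indicator A (R x + y) * indicator B y \<partial>lborel)" .
  qed
  also have "\<dots> = (\<integral>\<^sup>+x. (\<integral>\<^sup>+y. indicator A (R x + y) * indicator B y \<partial>lborel) \<partial>lborel)"
    by (rule lborel_pair.Fubini') measurable
  also have "\<dots> = (\<integral>\<^sup>+x. (\<integral>\<^sup>+y. indicator A y * indicator B (y - R x) \<partial>lborel) \<partial>lborel)"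
  proof (rule nn_integral_cong)
    fix x
    show "(\<integral>\<^sup>+y. indicator A (R x + y) * indicator B y \<partial>lborel)
        = (\<integral>\<^sup>+y. indicator A y * indicator B (y - R x) \<partial>lborel)"
      by (subst (2) lborel_distr_plus[of "R x", symmetric]) (simp add: nn_integral_distr)
  qed
  also have "\<dots> = (\<integral>\<^sup>+y. (\<integral>\<^sup>+x. indicator A y * indicator B (y - R x) \<partial>lborel) \<partial>lborel)"
    by (rule lborel_pair.Fubini') measurable
  also have "\<dots> = (\<integral>\<^sup>+y. indicator A y * emeasure lborel B \<partial>lborel)"
  proof (rule nn_integral_cong)
    fix y
    have "(indicator B (y - R x) :: ennreal) = indicator B (- R y + x)" for x
    proof -
      have "y - R x = R (R y) - R x" by (simp add: involution)
      then have "norm (y - R x) = norm (x - R y)"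
        by (simp add: diff_eq norm_part norm_minus_commute)
      then show ?thesis by (simp add: B_def indicator_def)
    qed
    moreover have "(\<integral>\<^sup>+x. indicator B (- R y + x) \<partial>lborel) = emeasure lborel B"
      by (subst (2) lborel_distr_plus[of "- R y", symmetric])
        (simp add: nn_integral_distr emeasure_distr flip: nn_integral_indicator)
    ultimately show "(\<integral>\<^sup>+x. indicator A y * indicator B (y - R x) \<partial>lborel)
        = indicator A y * emeasure lborel B"
      by (simp add: nn_integral_cmult)
  qed
  also have "\<dots> = emeasure lborel A * emeasure lborel B"
    by (simp add: nn_integral_multc)
  finally have "emeasure lborel (R -` A) * emeasure lborel B = emeasure lborel A * emeasure lborel B" .
  moreover have "emeasure lborel B \<noteq> 0" 
    unfolding B_def using unit_ball_vol_pos[of "real DIM('a)"] by (simp add: emeasure_ball less_le)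
  moreover have "emeasure lborel B \<noteq> \<infinity>"
    unfolding B_def using emeasure_lborel_ball_finite[of "0::'a" 1] by auto
  ultimately show ?thesis
    by (simp add: mult.commute[of _ "emeasure lborel B"] ennreal_mult_cancel_left)
qed

lemma distr_lborel: "distr lborel borel R = lborel"
  by (rule measure_eqI) (simp_all add: emeasure_distr borel_measurable_R emeasure_lborel_vimage)

lemma distr_lebesgue_lborel: "distr lebesgue lborel R = lborel"
proof -
  have "distr lebesgue lborel R = distr lborel lborel R"
    by (rule distr_completion) (simp add: borel_measurable_R)
  also have "\<dots> = lborel"
    using distr_lborel by (simp cong: distr_cong)
  finally show ?thesis .
qed

lemma measurable_lebesgue: "R \<in> lebesgue \<rightarrow>\<^sub>M lebesgue"
  by (rule completion.measurable_completion2)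
    (simp_all add: distr_lebesgue_lborel borel_measurable_R measurable_completion)

lemma distr_lebesgue: "distr lebesgue lebesgue R = lebesgue"
  using completion.completion_distr_eq[of R lborel lborel]
  by (simp add: distr_lebesgue_lborel borel_measurable_R measurable_completion)

lemma AE_reflect:
  assumes "AE x in lebesgue. P x"
  shows "AE x in lebesgue. P (R x)"
  using assms by (subst (asm) distr_lebesgue[symmetric]) (rule AE_distrD[OF measurable_lebesgue])

lemma sets_image: "S \<in> sets lebesgue \<Longrightarrow> R ` S \<in> sets lebesgue"
  using measurable_sets[OF measurable_lebesgue] by (simp add: image_eq_vimage)

lemma measurable_lebesgue_on: "R \<in> lebesgue_on (R ` S) \<rightarrow>\<^sub>M lebesgue_on S"
  by (auto intro!: measurable_restrict_space3 measurable_lebesgue simp: involution)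

lemma distr_lebesgue_on:
  assumes S: "S \<in> sets lebesgue"
  shows "distr (lebesgue_on (R ` S)) (lebesgue_on S) R = lebesgue_on S"
proof (rule measure_eqI)
  fix A assume "A \<in> sets (distr (lebesgue_on (R ` S)) (lebesgue_on S) R)"
  then have A: "A \<in> sets (lebesgue_on S)" by simp
  then have A': "A \<subseteq> S" "A \<in> sets lebesgue"
    using S by (auto simp: sets_restrict_space_iff)
  have "emeasure (distr (lebesgue_on (R ` S)) (lebesgue_on S) R) A
      = emeasure (lebesgue_on (R ` S)) (R ` A)"
    using A A' by (subst emeasure_distr[OF measurable_lebesgue_on])
      (auto simp: image_eq_vimage intro!: arg_cong[where f = "emeasure _"])
  also have "\<dots> = emeasure lebesgue (R -` A)"
    using A' sets_image[OF S] by (subst emeasure_restrict_space) (auto simp: image_eq_vimage)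
  also have "\<dots> = emeasure (distr lebesgue lebesgue R) A"
    using A' by (simp add: emeasure_distr measurable_lebesgue)
  also have "\<dots> = emeasure (lebesgue_on S) A"
    using A' S by (simp add: distr_lebesgue emeasure_restrict_space)
  finally show "emeasure (distr (lebesgue_on (R ` S)) (lebesgue_on S) R) A = emeasure (lebesgue_on S) A" .
qed simp

lemma borel_measurable_reflect_iff:
  "(\<lambda>x. h (R x)) \<in> borel_measurable (lebesgue_on (R ` S)) \<longleftrightarrow> h \<in> borel_measurable (lebesgue_on S)"
proof
  assume "(\<lambda>x. h (R x)) \<in> borel_measurable (lebesgue_on (R ` S))"
  from measurable_compose[OF measurable_lebesgue_on[of "R ` S", unfolded image_twice] this]
  show "h \<in> borel_measurable (lebesgue_on S)" by (simp add: involution)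
next
  assume "h \<in> borel_measurable (lebesgue_on S)"
  from measurable_compose[OF measurable_lebesgue_on this]
  show "(\<lambda>x. h (R x)) \<in> borel_measurable (lebesgue_on (R ` S))" .
qed

text \<open>
  Since \<open>R\<close> is its own inverse, \<open>h\<close> and \<open>h \<circ> R\<close> are measurable together, so the change of
  variables is an identity for arbitrary \<open>h\<close>; both integrals are \<open>0\<close> when \<open>h\<close> is not integrable.
\<close>
lemma integrable_reflect_iff:
  fixes h :: "'a \<Rightarrow> 'b::euclidean_space"
  assumes S: "S \<in> sets lebesgue"
  shows "integrable (lebesgue_on (R ` S)) (\<lambda>x. h (R x)) \<longleftrightarrow> integrable (lebesgue_on S) h"
proof (cases "h \<in> borel_measurable (lebesgue_on S)")
  case True
  then show ?thesis
    using integrable_distr_eq[OF measurable_lebesgue_on True] by (simp add: distr_lebesgue_on[OF S])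
next
  case False
  then show ?thesis
    using borel_measurable_reflect_iff[of h S] borel_measurable_integrable by blast
qed

lemma integral_reflect:
  fixes h :: "'a \<Rightarrow> 'b::euclidean_space"
  assumes S: "S \<in> sets lebesgue"
  shows "(LINT x|lebesgue_on (R ` S). h (R x)) = (LINT x|lebesgue_on S. h x)"
proof (cases "integrable (lebesgue_on S) h")
  case True
  then show ?thesis
    using integral_distr[OF measurable_lebesgue_on borel_measurable_integrable[OF True]]
    by (simp add: distr_lebesgue_on[OF S])
next
  case False
  then show ?thesis
    using integrable_reflect_iff[OF S, of h] by (simp add: not_integrable_integral_eq)
qed

end

text \<open>
  A consequence of the completeness of Lebesgue measure.
\<close>
lemma borel_measurable_lebesgue_on_cong_AE:
  fixes h k :: "'a::euclidean_space \<Rightarrow> real"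
  assumes "h \<in> borel_measurable (lebesgue_on S)" "S \<in> sets lebesgue"
    and "AE x in lebesgue. x \<in> S \<longrightarrow> h x = k x"
  shows "k \<in> borel_measurable (lebesgue_on S)"
proof -
  have "(\<lambda>x. if x \<in> S then h x else 0) \<in> borel_measurable lebesgue"
    using assms by (simp add: borel_measurable_if_I)
  then have "(\<lambda>x. if x \<in> S then k x else 0) \<in> borel_measurable lebesgue"
    by (rule borel_measurable_AE) (use assms(3) in auto)
  then show ?thesis by (rule borel_measurable_if_D)
qed


section \<open>Reflection of smooth functions\<close>

text \<open>
  \<open>Ck\<close> asks about the components of the gradient in the standard basis.  The gradient of
  \<open>\<phi> \<circ> R\<close> is \<open>L (D (R x))\<close>, whose components are those of \<open>D\<close> in the rotated basis; hence the need for
  closure under linear combinations.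
\<close>
lemma Ck_const: "Ck k (\<lambda>x::'a::euclidean_space. c)"
proof (induction k arbitrary: c)
  case (Suc k)
  show ?case
    using Suc GDERIV_const[of c] by (auto intro!: exI[of _ "\<lambda>x. 0"])
qed simp

lemma Ck_add: "Ck k \<phi> \<Longrightarrow> Ck k \<psi> \<Longrightarrow> Ck k (\<lambda>x. \<phi> x + \<psi> x)"
proof (induction k arbitrary: \<phi> \<psi>)
  case (Suc k)
  from Suc.prems obtain D E where
    "\<forall>x. GDERIV \<phi> x :> D x" "\<forall>b\<in>Basis. Ck k (\<lambda>x. D x \<bullet> b)"
    "\<forall>x. GDERIV \<psi> x :> E x" "\<forall>b\<in>Basis. Ck k (\<lambda>x. E x \<bullet> b)" by auto
  then show ?case
    using Suc.IH by (auto intro!: exI[of _ "\<lambda>x. D x + E x"] GDERIV_add simp: inner_add_left)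
qed (auto intro: continuous_intros)

lemma Ck_cmult: "Ck k \<phi> \<Longrightarrow> Ck k (\<lambda>x. c * \<phi> x)"
proof (induction k arbitrary: \<phi>)
  case (Suc k)
  from Suc.prems obtain D where D:
    "\<And>x. GDERIV \<phi> x :> D x" "\<forall>b\<in>Basis. Ck k (\<lambda>x. D x \<bullet> b)" by auto
  have "GDERIV (\<lambda>x. c * \<phi> x) x :> c *\<^sub>R D x" for x
    using GDERIV_mult[OF GDERIV_const D(1)] by simp
  then show ?case
    using Suc.IH D(2) by (auto intro!: exI[of _ "\<lambda>x. c *\<^sub>R D x"])
qed (auto intro: continuous_intros)

lemma Ck_sum: "finite A \<Longrightarrow> (\<And>i. i \<in> A \<Longrightarrow> Ck k (\<phi> i)) \<Longrightarrow> Ck k (\<lambda>x. \<Sum>i\<in>A. \<phi> i x)"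
  by (induction rule: finite_induct) (auto intro: Ck_const Ck_add)

lemma Ck_inner:
  assumes "\<forall>b\<in>Basis. Ck k (\<lambda>x. D x \<bullet> b)"
  shows "Ck k (\<lambda>x. D x \<bullet> w)"
proof -
  have "(\<lambda>x. D x \<bullet> w) = (\<lambda>x. \<Sum>b\<in>Basis. (w \<bullet> b) * (D x \<bullet> b))"
    by (subst euclidean_inner) (simp add: mult.commute)
  then show ?thesis
    using assms by (simp add: Ck_sum Ck_cmult)
qed

context isometric_involution
begin

lemma GDERIV_reflect:
  assumes "GDERIV \<phi> (R x) :> D"
  shows "GDERIV (\<lambda>x. \<phi> (R x)) x :> L D"
proof -
  have "((\<lambda>x. \<phi> (R x)) has_derivative (\<lambda>h. L h \<bullet> D)) (at x)"
    using has_derivative_compose[OF has_derivative assms[unfolded gderiv_def]] .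
  then show ?thesis by (simp add: gderiv_def part_selfadjoint)
qed

lemma Ck_reflect: "Ck k \<phi> \<Longrightarrow> Ck k (\<lambda>x. \<phi> (R x))"
proof (induction k arbitrary: \<phi>)
  case 0
  then show ?case
    using continuous_on_compose2[of UNIV \<phi> UNIV R] continuous by auto
next
  case (Suc k)
  from Suc.prems obtain D where D:
    "\<forall>x. GDERIV \<phi> x :> D x" "\<forall>b\<in>Basis. Ck k (\<lambda>x. D x \<bullet> b)" by auto
  have "Ck k (\<lambda>x. L (D (R x)) \<bullet> b)" for b
    using Suc.IH[OF Ck_inner[OF D(2), of "L b"]] by (simp add: part_selfadjoint)
  then show ?case
    using D(1) by (auto intro!: exI[of _ "\<lambda>x. L (D (R x))"] GDERIV_reflect)
qed

end


section \<open>Reflection of Sobolev functions\<close>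

context isometric_involution
begin

lemma Lp_reflect:
  fixes h :: "'a \<Rightarrow> 'b::euclidean_space"
  assumes "S \<in> sets lebesgue" "Lp S r h"
  shows "Lp (R ` S) r (\<lambda>x. h (R x))"
  using assms integrable_reflect_iff[OF assms(1), of "\<lambda>x. norm (h x) powr r"]
  by (simp add: Lp_def borel_measurable_reflect_iff)

lemma Lp_part:
  assumes "Lp S r h"
  shows "Lp S r (\<lambda>x. L (h x))"
proof -
  have "L \<in> borel_measurable borel"
    using bounded_linear_part borel_measurable_continuous_onI linear_continuous_on by blast
  with assms show ?thesis by (auto simp: Lp_def norm_part)
qed

lemma compact_image_iff: "compact (R ` K) \<longleftrightarrow> compact K"
  by (metis compact_continuous_image continuous image_twice)

lemma Lp_loc_reflect:
  fixes h :: "'a \<Rightarrow> 'b::euclidean_space"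
  assumes "Lp_loc \<Omega> r h" "R ` \<Omega> = \<Omega>"
  shows "Lp_loc \<Omega> r (\<lambda>x. h (R x))"
  unfolding Lp_loc_def
proof (intro allI impI, elim conjE)
  fix K assume K: "compact K" "K \<subseteq> \<Omega>"
  then have RK: "compact (R ` K)" "R ` K \<subseteq> \<Omega>"
    using assms(2) by (auto simp: compact_image_iff)
  then have "Lp (R ` K) r h" using assms(1) by (simp add: Lp_loc_def)
  moreover have "R ` K \<in> sets lebesgue"
    using RK(1) by (simp add: compact_imp_closed)
  ultimately show "Lp K r (\<lambda>x. h (R x))"
    using Lp_reflect[of "R ` K" r h] by (simp add: image_twice)
qed

lemma Lp_loc_part: "Lp_loc \<Omega> r h \<Longrightarrow> Lp_loc \<Omega> r (\<lambda>x. L (h x))"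
  by (auto simp: Lp_loc_def Lp_part)

text \<open>
  Test the gradient identity of \<open>u\<close> against \<open>\<phi> \<circ> R\<close>, apply \<open>L\<close> to both sides and change variables.
  \<open>L\<close> commutes with all these integrals, convergent or not, because it is invertible.
\<close>
lemma weak_gradient_reflect:
  assumes G: "weak_gradient \<Omega> u G" and \<Omega>: "R ` \<Omega> = \<Omega>" "\<Omega> \<in> sets lebesgue"
  shows "weak_gradient \<Omega> (\<lambda>x. u (R x)) (\<lambda>x. L (G (R x)))"
  unfolding weak_gradient_def
proof (intro conjI allI impI)
  show "Lp_loc \<Omega> 1 (\<lambda>x. u (R x))"
    using G \<Omega> by (simp add: weak_gradient_def Lp_loc_reflect)
  show "Lp_loc \<Omega> 1 (\<lambda>x. L (G (R x)))"
    using G \<Omega> by (simp add: weak_gradient_def Lp_loc_reflect Lp_loc_part)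
next
  fix \<phi> D
  assume "(\<forall>k. Ck k \<phi>) \<and> (\<forall>x. GDERIV \<phi> x :> D x) \<and>
    compact (closure {x. \<phi> x \<noteq> 0}) \<and> closure {x. \<phi> x \<noteq> 0} \<subseteq> \<Omega>"
  then have \<phi>: "\<forall>k. Ck k \<phi>" and D: "\<forall>x. GDERIV \<phi> x :> D x"
    and c: "compact (closure {x. \<phi> x \<noteq> 0})" "closure {x. \<phi> x \<noteq> 0} \<subseteq> \<Omega>"
    by auto
  have supp: "closure {x. \<phi> (R x) \<noteq> 0} = R ` closure {x. \<phi> x \<noteq> 0}"
    by (subst closure_image[symmetric]) (simp add: image_eq_vimage vimage_def)
  have int: "(LINT x|lebesgue_on \<Omega>. h (R x)) = (LINT x|lebesgue_on \<Omega>. h x)"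
    for h :: "'a \<Rightarrow> 'a"
    using integral_reflect[OF \<Omega>(2), of h] \<Omega>(1) by simp
  have intL: "(LINT x|lebesgue_on \<Omega>. L (h x)) = L (LINT x|lebesgue_on \<Omega>. h x)"
    for h :: "'a \<Rightarrow> 'a"
    by (rule integral_bounded_linear'[OF bounded_linear_part bounded_linear_part])
      (simp add: part_involution)
  have "\<forall>k. Ck k (\<lambda>x. \<phi> (R x))" using \<phi> Ck_reflect by blast
  moreover have "\<forall>x. GDERIV (\<lambda>x. \<phi> (R x)) x :> L (D (R x))" using D GDERIV_reflect by blast
  moreover have "compact (closure {x. \<phi> (R x) \<noteq> 0})" "closure {x. \<phi> (R x) \<noteq> 0} \<subseteq> \<Omega>"
    using c \<Omega>(1) by (auto simp: supp compact_image_iff)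
  ultimately have *: "(LINT x|lebesgue_on \<Omega>. u x *\<^sub>R L (D (R x)))
      = - (LINT x|lebesgue_on \<Omega>. \<phi> (R x) *\<^sub>R G x)"
    using G unfolding weak_gradient_def by simp
  have "(LINT x|lebesgue_on \<Omega>. u (R x) *\<^sub>R D x)
      = (LINT x|lebesgue_on \<Omega>. L (u x *\<^sub>R L (D (R x))))"
    by (subst int[symmetric])
      (simp add: linear_scale[OF linear_part] part_involution involution)
  also have "\<dots> = - L (LINT x|lebesgue_on \<Omega>. \<phi> (R x) *\<^sub>R G x)"
    by (simp only: intL * linear_neg[OF linear_part])
  also have "L (LINT x|lebesgue_on \<Omega>. \<phi> (R x) *\<^sub>R G x)
      = (LINT x|lebesgue_on \<Omega>. \<phi> x *\<^sub>R L (G (R x)))"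
    by (subst intL[symmetric], subst int[symmetric])
      (simp add: linear_scale[OF linear_part] involution)
  finally show "(LINT x|lebesgue_on \<Omega>. u (R x) *\<^sub>R D x)
      = - (LINT x|lebesgue_on \<Omega>. \<phi> x *\<^sub>R L (G (R x)))" .
qed

lemma W1p_reflect:
  assumes "W1p \<Omega> p u" "R ` \<Omega> = \<Omega>" "\<Omega> \<in> sets lebesgue"
  shows "W1p \<Omega> p (\<lambda>x. u (R x))"
proof -
  from assms(1) obtain G where "Lp \<Omega> p u" "weak_gradient \<Omega> u G" "Lp \<Omega> p G"
    by (auto simp: W1p_def)
  then show ?thesis
    unfolding W1p_def
    using Lp_part[OF Lp_reflect[of \<Omega> p G]] weak_gradient_reflect[OF _ assms(2,3)] assms(2,3)
      Lp_reflect[of \<Omega> p u]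
    by (intro conjI exI[of _ "\<lambda>x. L (G (R x))"]) simp_all
qed

lemma W1p_loc_reflect:
  assumes "W1p_loc \<Omega> p u" "R ` \<Omega> = \<Omega>" "\<Omega> \<in> sets lebesgue"
  shows "W1p_loc \<Omega> p (\<lambda>x. u (R x))"
proof -
  from assms(1) obtain G where "Lp_loc \<Omega> p u" "weak_gradient \<Omega> u G" "Lp_loc \<Omega> p G"
    by (auto simp: W1p_loc_def)
  then show ?thesis
    unfolding W1p_loc_def
    using Lp_loc_part[OF Lp_loc_reflect[of \<Omega> p G]] weak_gradient_reflect[OF _ assms(2,3)] assms(2,3)
      Lp_loc_reflect[of \<Omega> p u]
    by (intro conjI exI[of _ "\<lambda>x. L (G (R x))"]) simp_all
qed

lemma image_UNIV: "R ` UNIV = UNIV"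
  by (simp add: image_eq_vimage)

lemma AE_zero_outside_reflect:
  assumes "AE x in lebesgue. x \<notin> S \<longrightarrow> u x = (0::real)"
  shows "AE x in lebesgue. x \<notin> R ` S \<longrightarrow> u (R x) = 0"
  using AE_reflect[OF assms] by (simp add: image_eq_vimage)

lemma W1p0_reflect:
  assumes "W1p0 \<Omega> p u" "R ` \<Omega> = \<Omega>"
  shows "W1p0 \<Omega> p (\<lambda>x. u (R x))"
  using assms W1p_reflect[of UNIV p u] AE_zero_outside_reflect[of \<Omega> u]
  by (simp add: W1p0_def image_UNIV)

lemma Linf_c_reflect:
  assumes "Linf_c \<Omega> \<phi>" "R ` \<Omega> = \<Omega>"
  shows "Linf_c \<Omega> (\<lambda>x. \<phi> (R x))"
proof -
  from assms(1) obtain M K where *: "\<phi> \<in> borel_measurable lebesgue"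
    "AE x in lebesgue. \<bar>\<phi> x\<bar> \<le> M"
    "compact K" "K \<subseteq> \<Omega>" "AE x in lebesgue. x \<notin> K \<longrightarrow> \<phi> x = 0"
    by (auto simp: Linf_c_def)
  have "(\<lambda>x. \<phi> (R x)) \<in> borel_measurable lebesgue"
    using measurable_compose[OF measurable_lebesgue *(1)] .
  moreover have "compact (R ` K)" "R ` K \<subseteq> \<Omega>"
    using *(3,4) assms(2) by (auto simp: compact_image_iff)
  ultimately show ?thesis
    using AE_reflect[OF *(2)] AE_zero_outside_reflect[OF *(5)]
    unfolding Linf_c_def by blast
qed

lemma admissible_reflect:
  assumes u: "admissible \<Omega> p u" and \<Omega>: "R ` \<Omega> = \<Omega>" "\<Omega> \<in> sets lebesgue"
  shows "admissible \<Omega> p (\<lambda>x. u (R x))"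
  unfolding admissible_def
proof (intro conjI allI impI)
  show "W1p_loc \<Omega> p (\<lambda>x. u (R x))"
    using u \<Omega> by (simp add: admissible_def W1p_loc_reflect)
  show "AE x in lebesgue. x \<notin> \<Omega> \<longrightarrow> u (R x) = 0"
    using u AE_zero_outside_reflect[of \<Omega> u] \<Omega> by (simp add: admissible_def)
  show "\<exists>\<theta>\<ge>1. W1p0 \<Omega> p (\<lambda>x. u (R x) powr \<theta>)"
  proof -
    from u obtain \<theta> where "\<theta> \<ge> 1" "W1p0 \<Omega> p (\<lambda>x. u x powr \<theta>)" by (auto simp: admissible_def)
    with W1p0_reflect[OF this(2) \<Omega>(1)] show ?thesis by auto
  qed
next
  fix K assume "compact (closure K) \<and> closure K \<subseteq> \<Omega>"
  then have "compact (closure (R ` K)) \<and> closure (R ` K) \<subseteq> \<Omega>"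
    using \<Omega>(1) by (auto simp: closure_image compact_image_iff)
  then obtain C where "C > 0" "AE x in lebesgue. x \<in> R ` K \<longrightarrow> C \<le> u x"
    using u unfolding admissible_def by blast
  with AE_reflect[OF this(2)] show "\<exists>C>0. AE x in lebesgue. x \<in> K \<longrightarrow> C \<le> u (R x)"
    by (auto simp: mem_image)
qed

end


section \<open>Reflection of weak solutions\<close>

context isometric_involution
begin

lemma isometric_involution_prod: "isometric_involution (map_prod R R) (map_prod L L)"
proof (rule isometric_involution.intro)
  show "linear (map_prod L L)"
    using linear_part by (auto simp: linear_iff)
  show "norm (map_prod L L z) = norm z" for z
    by (cases z) (simp add: norm_Pair norm_part)
  show "map_prod R R z - map_prod R R w = map_prod L L (z - w)" for z w
    by (cases z; cases w) (simp add: diff_eq)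
  show "map_prod R R (map_prod R R z) = z" for z
    by (cases z) (simp add: involution)
qed

lemma local_integrand_reflect:
  "local_integrand p (\<lambda>x. L (G (R x))) H x = local_integrand p G (\<lambda>x. L (H (R x))) (R x)"
  by (simp add: local_integrand_def spow_def norm_part involution part_selfadjoint)

lemma nonlocal_integrand_reflect:
  "nonlocal_integrand s q (\<lambda>x. u (R x)) \<phi> z
    = nonlocal_integrand s q u (\<lambda>x. \<phi> (R x)) (map_prod R R z)"
  by (cases z) (simp add: nonlocal_integrand_def involution diff_eq norm_part)

text \<open>
  Each integral for \<open>u \<circ> R\<close> tested against \<open>\<phi>\<close> equals the one for \<open>u\<close> tested against \<open>\<phi> \<circ> R\<close>: the
  integrands correspond under \<open>R\<close>, or under the diagonal action of \<open>R\<close> for the nonlocal term, since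
  both only involve inner products and distances.  For the source term they correspond only
  almost everywhere, because of the symmetry of \<open>f\<close> and \<open>g\<close>.
\<close>
lemma weak_ineq_reflect:
  assumes u: "weak_ineq Rel \<Omega> s p q \<alpha> \<beta> f g u" and \<Omega>: "R ` \<Omega> = \<Omega>" "\<Omega> \<in> sets lebesgue"
    and f: "AE x in lebesgue. x \<in> \<Omega> \<longrightarrow> f (R x) = f x"
    and g: "AE x in lebesgue. x \<in> \<Omega> \<longrightarrow> g (R x) = g x"
  shows "weak_ineq Rel \<Omega> s p q \<alpha> \<beta> f g (\<lambda>x. u (R x))"
proof -
  interpret P: isometric_involution "map_prod R R" "map_prod L L"
    by (rule isometric_involution_prod)
  from u obtain G where G: "weak_gradient \<Omega> u G" "Lp_loc \<Omega> p G" and test: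
    "\<And>\<phi> H. W1p0 \<Omega> p \<phi> \<Longrightarrow> Linf_c \<Omega> \<phi> \<Longrightarrow> AE x in lebesgue. 0 \<le> \<phi> x \<Longrightarrow> weak_gradient UNIV \<phi> H \<Longrightarrow>
       integrable (lebesgue_on \<Omega>) (local_integrand p G H) \<and>
       integrable lebesgue (nonlocal_integrand s q u \<phi>) \<and>
       integrable (lebesgue_on \<Omega>) (source_integrand \<alpha> \<beta> f g u \<phi>) \<and>
       Rel ((LINT x|lebesgue_on \<Omega>. local_integrand p G H x) +
            (LINT z|lebesgue. nonlocal_integrand s q u \<phi> z))
           (LINT x|lebesgue_on \<Omega>. source_integrand \<alpha> \<beta> f g u \<phi> x)"
    unfolding weak_ineq_def by blast
  show ?thesis
    unfolding weak_ineq_def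
  proof (intro exI[of _ "\<lambda>x. L (G (R x))"] conjI allI impI)
    show "weak_gradient \<Omega> (\<lambda>x. u (R x)) (\<lambda>x. L (G (R x)))"
      by (rule weak_gradient_reflect[OF G(1) \<Omega>])
    show "Lp_loc \<Omega> p (\<lambda>x. L (G (R x)))"
      by (rule Lp_loc_part[OF Lp_loc_reflect[OF G(2) \<Omega>(1)]])
  next
    fix \<phi> H assume \<phi>: "W1p0 \<Omega> p \<phi> \<and> Linf_c \<Omega> \<phi> \<and> (AE x in lebesgue. 0 \<le> \<phi> x) \<and>
          weak_gradient UNIV \<phi> H"
    let ?\<phi> = "\<lambda>x. \<phi> (R x)" and ?H = "\<lambda>x. L (H (R x))"
    have t: "integrable (lebesgue_on \<Omega>) (local_integrand p G ?H)"
       "integrable lebesgue (nonlocal_integrand s q u ?\<phi>)"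
       "integrable (lebesgue_on \<Omega>) (source_integrand \<alpha> \<beta> f g u ?\<phi>)"
       "Rel ((LINT x|lebesgue_on \<Omega>. local_integrand p G ?H x) +
            (LINT z|lebesgue. nonlocal_integrand s q u ?\<phi> z))
           (LINT x|lebesgue_on \<Omega>. source_integrand \<alpha> \<beta> f g u ?\<phi> x)"
    proof -
      have "W1p0 \<Omega> p ?\<phi>" using W1p0_reflect \<phi> \<Omega>(1) by simp
      moreover have "Linf_c \<Omega> ?\<phi>" using Linf_c_reflect \<phi> \<Omega>(1) by simp
      moreover have "AE x in lebesgue. 0 \<le> ?\<phi> x" using AE_reflect[of "\<lambda>x. 0 \<le> \<phi> x"] \<phi> by simp
      moreover have "weak_gradient UNIV ?\<phi> ?H"
        using weak_gradient_reflect[of UNIV \<phi> H] \<phi> by (simp add: image_UNIV)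
      ultimately show "integrable (lebesgue_on \<Omega>) (local_integrand p G ?H)"
       "integrable lebesgue (nonlocal_integrand s q u ?\<phi>)"
       "integrable (lebesgue_on \<Omega>) (source_integrand \<alpha> \<beta> f g u ?\<phi>)"
       "Rel ((LINT x|lebesgue_on \<Omega>. local_integrand p G ?H x) +
            (LINT z|lebesgue. nonlocal_integrand s q u ?\<phi> z))
           (LINT x|lebesgue_on \<Omega>. source_integrand \<alpha> \<beta> f g u ?\<phi> x)"
        using test by blast+
    qed
    have loc: "integrable (lebesgue_on \<Omega>) (local_integrand p (\<lambda>x. L (G (R x))) H)"
      "(LINT x|lebesgue_on \<Omega>. local_integrand p (\<lambda>x. L (G (R x))) H x)
        = (LINT x|lebesgue_on \<Omega>. local_integrand p G ?H x)"
      using t(1) integrable_reflect_iff[OF \<Omega>(2), of "local_integrand p G ?H"]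
        integral_reflect[OF \<Omega>(2), of "local_integrand p G ?H"] \<Omega>(1)
      by (simp_all add: local_integrand_reflect[abs_def])
    have nonloc: "integrable lebesgue (nonlocal_integrand s q (\<lambda>x. u (R x)) \<phi>)"
      "(LINT z|lebesgue. nonlocal_integrand s q (\<lambda>x. u (R x)) \<phi> z)
        = (LINT z|lebesgue. nonlocal_integrand s q u ?\<phi> z)"
      using t(2) P.integrable_reflect_iff[of UNIV "nonlocal_integrand s q u ?\<phi>"]
        P.integral_reflect[of UNIV "nonlocal_integrand s q u ?\<phi>"]
      by (simp_all add: nonlocal_integrand_reflect[abs_def] P.image_UNIV lebesgue_on_UNIV_eq)
    let ?S = "source_integrand \<alpha> \<beta> f g u ?\<phi>"
    have S: "integrable (lebesgue_on \<Omega>) (\<lambda>x. ?S (R x))"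
      "(LINT x|lebesgue_on \<Omega>. ?S (R x)) = (LINT x|lebesgue_on \<Omega>. ?S x)"
      using t(3) integrable_reflect_iff[OF \<Omega>(2), of ?S] integral_reflect[OF \<Omega>(2), of ?S] \<Omega>(1)
      by simp_all
    have ae: "AE x in lebesgue. x \<in> \<Omega> \<longrightarrow> ?S (R x) = source_integrand \<alpha> \<beta> f g (\<lambda>x. u (R x)) \<phi> x"
      using f g by eventually_elim (simp add: source_integrand_def involution)
    then have ae': "AE x in lebesgue_on \<Omega>. ?S (R x) = source_integrand \<alpha> \<beta> f g (\<lambda>x. u (R x)) \<phi> x"
      using \<Omega>(2) by (simp add: AE_restrict_space_iff)
    have m: "source_integrand \<alpha> \<beta> f g (\<lambda>x. u (R x)) \<phi> \<in> borel_measurable (lebesgue_on \<Omega>)"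
      using borel_measurable_lebesgue_on_cong_AE[OF borel_measurable_integrable[OF S(1)] \<Omega>(2) ae] by simp
    have src: "integrable (lebesgue_on \<Omega>) (source_integrand \<alpha> \<beta> f g (\<lambda>x. u (R x)) \<phi>)"
      using integrable_cong_AE_imp[OF S(1) m ae'] .
    have "(LINT x|lebesgue_on \<Omega>. source_integrand \<alpha> \<beta> f g (\<lambda>x. u (R x)) \<phi> x)
        = (LINT x|lebesgue_on \<Omega>. ?S x)"
      using integral_cong_AE[OF borel_measurable_integrable[OF S(1)] m ae'] S(2) by simp
    with t(4) loc nonloc src
    show "integrable (lebesgue_on \<Omega>) (local_integrand p (\<lambda>x. L (G (R x))) H)"
      "integrable lebesgue (nonlocal_integrand s q (\<lambda>x. u (R x)) \<phi>)"
      "integrable (lebesgue_on \<Omega>) (source_integrand \<alpha> \<beta> f g (\<lambda>x. u (R x)) \<phi>)"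
      "Rel ((LINT x|lebesgue_on \<Omega>. local_integrand p (\<lambda>x. L (G (R x))) H x) +
            (LINT z|lebesgue. nonlocal_integrand s q (\<lambda>x. u (R x)) \<phi> z))
           (LINT x|lebesgue_on \<Omega>. source_integrand \<alpha> \<beta> f g (\<lambda>x. u (R x)) \<phi> x)"
      by simp_all
  qed
qed

lemma weak_solution_reflect:
  assumes "weak_solution \<Omega> s p q \<alpha> \<beta> f g u" and "R ` \<Omega> = \<Omega>" "\<Omega> \<in> sets lebesgue"
    and "AE x in lebesgue. x \<in> \<Omega> \<longrightarrow> f (R x) = f x"
    and "AE x in lebesgue. x \<in> \<Omega> \<longrightarrow> g (R x) = g x"
  shows "weak_solution \<Omega> s p q \<alpha> \<beta> f g (\<lambda>x. u (R x))"
  using assms unfolding weak_solution_def weak_subsolution_def weak_supersolution_def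
  by (auto intro: admissible_reflect weak_ineq_reflect)

end

lemma isometric_involution_hyperplane_reflection:
  assumes "norm \<upsilon> = 1"
  shows "isometric_involution (hyperplane_reflection \<upsilon> c) (hyperplane_reflection \<upsilon> 0)"
proof (rule isometric_involution.intro)
  have v: "\<upsilon> \<bullet> \<upsilon> = 1" using assms by (simp add: dot_square_norm)
  show "linear (hyperplane_reflection \<upsilon> 0)"
    by (auto simp: linear_iff hyperplane_reflection_def algebra_simps)
  show "norm (hyperplane_reflection \<upsilon> 0 x) = norm x" for x
    by (simp add: norm_eq hyperplane_reflection_def inner_diff_left inner_diff_right v inner_commute[of \<upsilon> x])
  show "hyperplane_reflection \<upsilon> c x - hyperplane_reflection \<upsilon> c y = hyperplane_reflection \<upsilon> 0 (x - y)" for x y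
    by (simp add: hyperplane_reflection_def algebra_simps)
  show "hyperplane_reflection \<upsilon> c (hyperplane_reflection \<upsilon> c x) = x" for x
    by (simp add: hyperplane_reflection_def v algebra_simps)
qed

lemma unique_weak_solution_symmetric:
  assumes u: "unique_weak_solution \<Omega> s p q \<alpha> \<beta> f g u" and "\<Omega> \<in> sets lebesgue"
    and "norm \<upsilon> = 1" "symmetric_set \<upsilon> c \<Omega>" "symmetric_on \<Omega> \<upsilon> c f" "symmetric_on \<Omega> \<upsilon> c g"
  shows "symmetric_on UNIV \<upsilon> c u"
proof -
  interpret isometric_involution "hyperplane_reflection \<upsilon> c" "hyperplane_reflection \<upsilon> 0"
    by (rule isometric_involution_hyperplane_reflection) fact
  have "weak_solution \<Omega> s p q \<alpha> \<beta> f g (\<lambda>x. u (hyperplane_reflection \<upsilon> c x))"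
    using assms by (intro weak_solution_reflect)
      (auto simp: unique_weak_solution_def symmetric_set_def symmetric_on_def)
  then show ?thesis
    using u by (auto simp: unique_weak_solution_def symmetric_on_def)
qed


section \<open>Radial symmetry\<close>

text \<open>
  Measurability on the whole space comes from \<open>u\<^sup>\<theta>\<close>, which lies in a global Sobolev space; taking
  the \<open>\<theta>\<close>-th root recovers \<open>u\<close>, which is positive almost everywhere in \<open>\<Omega>\<close> and zero almost everywhere outside.
\<close>
lemma admissible_borel_measurable:
  assumes u: "admissible \<Omega> p u" and "open \<Omega>"
  shows "u \<in> borel_measurable lebesgue"
proof -
  from u obtain \<theta> where \<theta>: "\<theta> \<ge> 1" "W1p0 \<Omega> p (\<lambda>x. u x powr \<theta>)"
    by (auto simp: admissible_def)
  obtain C :: "nat \<Rightarrow> 'a set" where C: "\<And>n. compact (C n)" "\<And>n. C n \<subseteq> \<Omega>" "\<Union>(range C) = \<Omega>"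
    using open_Union_compact_subsets[OF \<open>open \<Omega>\<close>] by metis
  have "AE x in lebesgue. x \<in> C n \<longrightarrow> 0 < u x" for n :: nat
  proof -
    have "compact (closure (C n)) \<and> closure (C n) \<subseteq> \<Omega>"
      using C(1,2)[of n] by (simp add: compact_imp_closed)
    then obtain c where "c > 0" "AE x in lebesgue. x \<in> C n \<longrightarrow> c \<le> u x"
      using u unfolding admissible_def by blast
    then show ?thesis by auto
  qed
  then have "AE x in lebesgue. \<forall>n. x \<in> C n \<longrightarrow> 0 < u x"
    by (subst AE_all_countable) simp
  moreover have "AE x in lebesgue. x \<notin> \<Omega> \<longrightarrow> u x = 0"
    using u by (simp add: admissible_def)
  ultimately have "AE x in lebesgue. (u x powr \<theta>) powr (1 / \<theta>) = u x"
  proof eventually_elim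
    fix x assume x: "\<forall>n. x \<in> C n \<longrightarrow> 0 < u x" "x \<notin> \<Omega> \<longrightarrow> u x = 0"
    have "0 \<le> u x"
    proof (cases "x \<in> \<Omega>")
      case True
      then obtain n where "x \<in> C n" using C(3) by blast
      then show ?thesis using x(1) less_imp_le by blast
    qed (simp add: x(2))
    then show "(u x powr \<theta>) powr (1 / \<theta>) = u x"
      using \<theta>(1) by (simp add: powr_powr)
  qed
  moreover have "(\<lambda>x. u x powr \<theta>) \<in> borel_measurable lebesgue"
    using \<theta>(2) by (simp add: W1p0_def W1p_def Lp_def lebesgue_on_UNIV_eq)
  then have "(\<lambda>x. (u x powr \<theta>) powr (1 / \<theta>)) \<in> borel_measurable lebesgue"
    by measurable
  ultimately show ?thesis
    using borel_measurable_AE by blast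
qed

text \<open>
  The reflection across the hyperplane through the origin orthogonal to \<open>v\<close>, with an axis that
  need not be normalised so that \<open>v\<close> can range over the whole space in Fubini arguments.
  For \<open>v = 0\<close> it is the identity.
\<close>
definition reflect_along :: "'a::euclidean_space \<Rightarrow> 'a \<Rightarrow> 'a" where
  "reflect_along v x = x - (2 * (x \<bullet> v) / (v \<bullet> v)) *\<^sub>R v"

lemma reflect_along_eq:
  "v \<noteq> 0 \<Longrightarrow> reflect_along v x = hyperplane_reflection ((1 / norm v) *\<^sub>R v) 0 x"
  by (simp add: reflect_along_def hyperplane_reflection_def dot_square_norm power2_eq_square)

text \<open>
  The inverse of \<open>y \<mapsto> |y| e - y\<close>.  The vector \<open>|y| e - y\<close> is an axis of the
  reflection that exchanges the directions \<open>e\<close> and \<open>y / |y|\<close>; for fixed \<open>e\<close> this parametrises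
  axes by directions.
\<close>
definition direction_of_axis :: "'a::euclidean_space \<Rightarrow> 'a \<Rightarrow> 'a" where
  "direction_of_axis e v = ((v \<bullet> v) / (2 * (v \<bullet> e))) *\<^sub>R e - v"

lemma direction_of_axis_differentiable:
  "direction_of_axis e differentiable_on {v. 0 < v \<bullet> e}"
  unfolding differentiable_on_def direction_of_axis_def
  by (auto intro!: derivative_intros)

lemma axis_of_direction:
  assumes e: "norm e = 1" and y: "y \<noteq> norm y *\<^sub>R e"
  defines "v \<equiv> norm y *\<^sub>R e - y"
  shows "0 < v \<bullet> e" "direction_of_axis e v = y"
    and "reflect_along v (r *\<^sub>R e) = (r / norm y) *\<^sub>R y"
proof -
  have ee: "e \<bullet> e = 1" using e by (simp add: dot_square_norm)
  have "y \<noteq> 0" using y by auto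
  then have ny: "norm y > 0" by simp
  have ve: "v \<bullet> e = norm y - y \<bullet> e" by (simp add: v_def inner_diff_left ee)
  have yy: "y \<bullet> y = norm y * norm y" by (simp add: dot_square_norm power2_eq_square)
  have vv: "v \<bullet> v = 2 * norm y * (v \<bullet> e)"
  proof -
    have "(t *\<^sub>R e - y) \<bullet> (t *\<^sub>R e - y) = 2 * t * (t - y \<bullet> e)" if "y \<bullet> y = t * t" for t
      using that
      by (simp add: inner_diff_left inner_diff_right ee inner_commute[of e y] right_diff_distrib)
    from this[OF yy] show ?thesis by (simp only: ve v_def[symmetric])
  qed
  have "v \<noteq> 0" using y by (simp add: v_def)
  then have "0 < v \<bullet> v" by simp
  then show pos: "0 < v \<bullet> e" using ny by (simp add: vv zero_less_mult_iff)
  show "direction_of_axis e v = y"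
    using pos by (simp add: direction_of_axis_def vv) (simp add: v_def)
  have "reflect_along v (r *\<^sub>R e) = r *\<^sub>R e - (r / norm y) *\<^sub>R v"
    using pos ny by (simp add: reflect_along_def vv inner_commute[of e v])
  also have "\<dots> = (r / norm y) *\<^sub>R y"
    using ny by (simp add: v_def scaleR_diff_right)
  finally show "reflect_along v (r *\<^sub>R e) = (r / norm y) *\<^sub>R y" .
qed

text \<open>
  The exceptional axes form a null set, and the smooth map \<open>direction_of_axis\<close> sends it to a
  null set of exceptional directions.  What is gained is that the argument of \<open>w\<close> depends on \<open>x\<close> through
  \<open>norm x\<close> alone.
\<close>
lemma AE_sphere_const:
  fixes w :: "'a::euclidean_space \<Rightarrow> real"
  assumes x: "x \<noteq> 0" and ae: "AE v in lborel. w (reflect_along v x) = w x"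
  shows "AE y in lborel. w ((norm x / norm y) *\<^sub>R y) = w x"
proof -
  define e where "e = (1 / norm x) *\<^sub>R x"
  have e: "norm e = 1" "norm x *\<^sub>R e = x" using x by (simp_all add: e_def)
  define N where "N = {v. w (reflect_along v x) \<noteq> w x} \<inter> {v. 0 < v \<bullet> e}"
  have "AE v in lebesgue. w (reflect_along v x) = w x"
    using ae by (rule AE_completion)
  then have "{v. w (reflect_along v x) \<noteq> w x} \<in> null_sets lebesgue"
    by (simp add: completion.AE_iff_null_sets)
  then have "negligible {v. w (reflect_along v x) \<noteq> w x}"
    by (simp add: negligible_iff_null_sets)
  then have "negligible N" by (rule negligible_subset) (auto simp: N_def)
  moreover have "direction_of_axis e differentiable_on N"
    by (rule differentiable_on_subset[OF direction_of_axis_differentiable]) (auto simp: N_def)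
  ultimately have "negligible (direction_of_axis e ` N)"
    by (intro negligible_differentiable_image_negligible) auto
  then have "AE y in lborel. y \<notin> direction_of_axis e ` N"
    by (subst AE_completion_iff[symmetric], intro AE_not_in) (simp add: negligible_iff_null_sets)
  moreover have "AE y in lborel. y \<noteq> (0::'a)"
    by (rule AE_lborel_singleton)
  ultimately show ?thesis
  proof eventually_elim
    fix y assume y: "y \<notin> direction_of_axis e ` N" "y \<noteq> 0"
    show "w ((norm x / norm y) *\<^sub>R y) = w x"
    \<comment> \<open>If \<open>y\<close> points in the direction of \<open>x\<close>, its axis degenerates to \<open>0\<close>, but the claim is trivial.\<close>
    proof (cases "y = norm y *\<^sub>R e")
      case True
      then have "(norm x / norm y) *\<^sub>R y = (norm x / norm y) *\<^sub>R (norm y *\<^sub>R e)"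
        by (rule arg_cong)
      also have "\<dots> = x" using y(2) e(2) by simp
      finally show ?thesis by simp
    next
      case False
      note a = axis_of_direction[OF e(1) False]
      have "norm y *\<^sub>R e - y \<notin> N" using y(1) a(2) by (metis image_eqI)
      then show ?thesis using a(1) a(3)[of "norm x"] by (simp add: N_def e(2))
    qed
  qed
qed

text \<open>
  The null set outside of which \<open>u (R x) = u x\<close> depends on the reflection \<open>R\<close>, so the reflections
  cannot simply be composed pointwise.  Fubini's theorem gives for almost every \<open>x\<close> invariance
  under almost every axis, hence \<open>u (|x| y / |y|) = u x\<close> for almost every \<open>y\<close>.  After a second
  exchange of quantifiers a single good \<open>y\<close> serves almost all \<open>x\<close>, and \<open>u\<close> restricted to the ray
  through \<open>y\<close> is the radial profile.
\<close>
lemma radial_if_symmetric: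
  fixes u :: "'a::euclidean_space \<Rightarrow> real"
  assumes u: "u \<in> borel_measurable lebesgue"
    and sym: "\<And>\<upsilon>. norm \<upsilon> = 1 \<Longrightarrow> symmetric_on UNIV \<upsilon> 0 u"
  shows "radial_on UNIV u"
proof -
  obtain w where w[measurable]: "w \<in> borel_measurable borel" and uw: "AE x in lborel. u x = w x"
    using completion_ex_borel_measurable_real[OF u] by auto
  \<comment> \<open>A Borel representative makes the exceptional sets in the product space measurable.\<close>
  have uw': "AE x in lebesgue. u x = w x" using uw by (rule AE_completion)
  have "AE x in lborel. w (reflect_along v x) = w x" for v
  proof (cases "v = 0")
    case False
    define \<upsilon> where "\<upsilon> = (1 / norm v) *\<^sub>R v"
    have \<upsilon>: "norm \<upsilon> = 1" using False by (simp add: \<upsilon>_def)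
    interpret isometric_involution "hyperplane_reflection \<upsilon> 0" "hyperplane_reflection \<upsilon> 0"
      by (rule isometric_involution_hyperplane_reflection[OF \<upsilon>])
    have "AE x in lebesgue. w (reflect_along v x) = w x"
      using uw' AE_reflect[OF uw'] sym[OF \<upsilon>, unfolded symmetric_on_def]
      by eventually_elim (simp add: reflect_along_eq[OF False] \<upsilon>_def)
    then show ?thesis by (simp add: AE_completion_iff)
  qed (simp add: reflect_along_def)
  then have "AE v in lborel. AE x in lborel. w (reflect_along v x) = w x" by simp
  then have "AE x in lborel. AE v in lborel. w (reflect_along v x) = w x"
  proof (subst (asm) lborel_pair.AE_commute)
    have "Measurable.pred (borel \<Otimes>\<^sub>M borel) (\<lambda>z. w (reflect_along (fst z) (snd z)) = w (snd z))"
      unfolding reflect_along_def by measurable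
    then show "{z \<in> space (lborel \<Otimes>\<^sub>M lborel). w (reflect_along (fst z) (snd z)) = w (snd z)}
        \<in> sets (lborel \<Otimes>\<^sub>M lborel)"
      by (simp add: pred_def space_pair_measure)
  qed
  moreover have "AE x in lborel. x \<noteq> (0::'a)" by (rule AE_lborel_singleton)
  ultimately have "AE x in lborel. AE y in lborel. w ((norm x / norm y) *\<^sub>R y) = w x"
    by eventually_elim (rule AE_sphere_const)
  then have "AE y in lborel. AE x in lborel. w ((norm x / norm y) *\<^sub>R y) = w x"
  proof (subst (asm) lborel_pair.AE_commute)
    have "Measurable.pred (borel \<Otimes>\<^sub>M borel)
        (\<lambda>z. w ((norm (fst z) / norm (snd z)) *\<^sub>R snd z) = w (fst z))"
      by measurable
    then show "{z \<in> space (lborel \<Otimes>\<^sub>M lborel).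
        w ((norm (fst z) / norm (snd z)) *\<^sub>R snd z) = w (fst z)} \<in> sets (lborel \<Otimes>\<^sub>M lborel)"
      by (simp add: pred_def space_pair_measure)
  qed
  then obtain y where y: "AE x in lborel. w ((norm x / norm y) *\<^sub>R y) = w x"
    using eventually_happens'[of "ae_filter lborel"] by (auto simp: ae_filter_eq_bot_iff)
  show ?thesis
    unfolding radial_on_def
  proof
    show "AE x in lebesgue. x \<in> UNIV \<longrightarrow> u x = w ((norm x / norm y) *\<^sub>R y)"
      using uw' AE_completion[OF y] by eventually_elim simp
  qed
qed

lemma symmetric_set_if_radial:
  assumes "norm \<upsilon> = 1" "\<Omega> = {x. norm x \<in> A}"
  shows "symmetric_set \<upsilon> 0 \<Omega>"
proof -
  interpret isometric_involution "hyperplane_reflection \<upsilon> 0" "hyperplane_reflection \<upsilon> 0"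
    by (rule isometric_involution_hyperplane_reflection) fact
  show ?thesis
    unfolding symmetric_set_def image_eq_vimage assms(2) by (auto simp: norm_part)
qed

lemma symmetric_on_if_radial:
  assumes "norm \<upsilon> = 1" "\<Omega> = {x. norm x \<in> A}" "radial_on \<Omega> h"
  shows "symmetric_on \<Omega> \<upsilon> 0 h"
proof -
  interpret isometric_involution "hyperplane_reflection \<upsilon> 0" "hyperplane_reflection \<upsilon> 0"
    by (rule isometric_involution_hyperplane_reflection) fact
  from assms(3) obtain \<rho> where \<rho>: "AE x in lebesgue. x \<in> \<Omega> \<longrightarrow> h x = \<rho> (norm x)"
    by (auto simp: radial_on_def)
  show ?thesis
    unfolding symmetric_on_def using \<rho> AE_reflect[OF \<rho>]
    by eventually_elim (simp add: assms(2) norm_part)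
qed


section \<open>Symmetry of the solution\<close>

theorem corollary1p12:
  fixes \<Omega> :: "'a::euclidean_space set"
    and f g u :: "'a \<Rightarrow> real"
    and s p q \<alpha> \<beta> :: real
  assumes "bounded_C2_domain \<Omega>"
    and "0 < s" "s < 1"
    and "1 < q" "q \<le> p"
    and "p < real DIM('a)"
    and "0 < \<beta>" "\<beta> < q - 1"
    and "0 < \<alpha>"
    and "f \<in> borel_measurable (lebesgue_on \<Omega>)" "\<forall>x\<in>\<Omega>. 0 \<le> f x"
    and "g \<in> borel_measurable (lebesgue_on \<Omega>)" "\<forall>x\<in>\<Omega>. 0 \<le> g x"
    and "Lp \<Omega> (conj_exp (sobolev_exp TYPE('a) p / (\<beta> + 1))) g"
    and "cond_F1 \<Omega> p \<alpha> f \<or> cond_F2 \<Omega> p f"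
    and "unique_weak_solution \<Omega> s p q \<alpha> \<beta> f g u"
  shows "(\<forall>\<upsilon> c. norm \<upsilon> = 1 \<and> symmetric_set \<upsilon> c \<Omega> \<and>
             symmetric_on \<Omega> \<upsilon> c f \<and> symmetric_on \<Omega> \<upsilon> c g \<longrightarrow>
             symmetric_on UNIV \<upsilon> c u) \<and>
         (((\<exists>r>0. \<Omega> = ball 0 r) \<or>
           (\<exists>a b. 0 < a \<and> a < b \<and> \<Omega> = {x. a < norm x \<and> norm x < b})) \<and>
             radial_on \<Omega> f \<and> radial_on \<Omega> g \<longrightarrow>
             radial_on UNIV u)"
proof -
  have open_\<Omega>: "open \<Omega>" using assms(1) by (simp add: bounded_C2_domain_def)
  then have sets_\<Omega>: "\<Omega> \<in> sets lebesgue" by (simp add: borel_open)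
  note sym = unique_weak_solution_symmetric[OF assms(16) sets_\<Omega>]
  have "radial_on UNIV u"
    if \<Omega>: "(\<exists>r>0. \<Omega> = ball 0 r) \<or> (\<exists>a b. 0 < a \<and> a < b \<and> \<Omega> = {x. a < norm x \<and> norm x < b})"
      and fg: "radial_on \<Omega> f" "radial_on \<Omega> g"
  proof -
    obtain A where A: "\<Omega> = {x. norm x \<in> A}"
    proof -
      from \<Omega> consider r where "\<Omega> = ball 0 r" | a b where "\<Omega> = {x. a < norm x \<and> norm x < b}"
        by blast
      then show thesis
      proof cases
        case (1 r)
        then show thesis by (intro that[of "{..<r}"]) auto
      next
        case (2 a b)
        then show thesis by (intro that[of "{a<..<b}"]) auto
      qed
    qed
    have "admissible \<Omega> p u"
      using assms(16)
      by (simp add: unique_weak_solution_def weak_solution_def weak_subsolution_def)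
    then have "u \<in> borel_measurable lebesgue"
      using open_\<Omega> by (rule admissible_borel_measurable)
    then show ?thesis
    proof (rule radial_if_symmetric)
      fix \<upsilon> :: 'a assume \<upsilon>: "norm \<upsilon> = 1"
      show "symmetric_on UNIV \<upsilon> 0 u"
        using \<upsilon> symmetric_set_if_radial[OF \<upsilon> A] symmetric_on_if_radial[OF \<upsilon> A fg(1)]
          symmetric_on_if_radial[OF \<upsilon> A fg(2)]
        by (rule sym)
    qed
  qed
  then show ?thesis using sym by blast
qed

end
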